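(* Suppose that every prime $q\ge 5$ can be written as $q=n^2+n+p$ with $p$ a twin prime and $n\ge 1$ an integer. Then $\pi_2(x)\gg \frac{\sqrt{x}}{\log x}$. In particular, there exist infinitely many twin primes.
   Context: A twin prime is a prime $p$ such that $p-2$ or $p+2$ is also prime. $\pi_2(x)$ is the number of twin primes less than or equal to $x$. For functions $\psi,\phi:[0,\infty)\to\mathbb{R}$, $\psi(x)\gg\phi(x)$ means $\psi(x)\ge\phi(x)$ for all sufficiently large $x$. *)

theory Defs
  imports Complex_Main "HOL-Computational_Algebra.Primes"
begin

text \<open>The subtraction is never truncated here: \<open>prime p\<close> gives \<open>p \<ge> 2\<close>.\<close>
definition twin_prime :: "nat \<Rightarrow> bool" where
  "twin_prime p \<longleftrightarrow> prime p \<and> (prime (p - 2) \<or> prime (p + 2))"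

definition twin_prime_count :: "real \<Rightarrow> nat" where
  "twin_prime_count x = card {p. twin_prime p \<and> real p \<le> x}"

end

(* Only about sqrt x values of n are available, so the representations of the primes up to x as
   n^2 + n + p bound the prime count by about sqrt x times the number T of twin primes up to x.
   Getting the constant 1 takes two savings. First, twin primes other than 3 fall about evenly into
   the residue classes 1 and 2 modulo 3, and p = 1, n = 1 (mod 3) would make n^2 + n + p divisible
   by 3; hence the factor 5/6. Second, a Chebyshev bound with a constant above 5/6 is needed: the
   combination n!(n/12)! / ((n/2)!(n/3)!(n/4)!) gives ln 27648 / 12, which works as e^10 < 27648. *)
theory Submission
  imports Defs "HOL-Number_Theory.Prime_Powers" "HOL-Analysis.Complex_Transcendental"
    "HOL-Real_Asymp.Real_Asymp"
begin

section \<open>Residue classes modulo 3\<close>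

text \<open>Every block of three consecutive integers starting at 1 begins with the excluded class,
  so s/3 rounded up, which is \<open>(s + 2) div 3\<close>, numbers are removed. What matters later
  is that at most two thirds of the range remains.\<close>

lemma card_not_1_mod_3: "card {n \<in> {1..s}. n mod 3 \<noteq> 1} = s - (s + 2) div (3::nat)"
proof (induction s)
  case (Suc s)
  have *: "{n \<in> {1..Suc s}. n mod 3 \<noteq> 1} =
      (if Suc s mod 3 = 1 then {n \<in> {1..s}. n mod 3 \<noteq> 1}
       else insert (Suc s) {n \<in> {1..s}. n mod 3 \<noteq> 1})"
    by (auto simp: le_Suc_eq)
  define a b where "a = (s + 2) div 3" and "b = (Suc s + 2) div 3"
  have "b = (if Suc s mod 3 = 1 then Suc a else a)"
    using div_Suc[of "s + 2" 3] mod_Suc[of "s + 2" 3] mod_Suc[of s 3] mod_Suc[of "Suc s" 3]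
      mod_less_divisor[of 3 s]
    by (auto simp: a_def b_def split: if_splits)
  moreover have "a \<le> s" unfolding a_def by linarith
  moreover have "card {n \<in> {1..s}. n mod 3 \<noteq> 1} = s - a"
    unfolding a_def by (rule Suc.IH)
  ultimately have "card {n \<in> {1..Suc s}. n mod 3 \<noteq> 1} = Suc s - b"
    unfolding * by (simp add: Suc_diff_le)
  then show ?case by (simp only: b_def)
qed simp

text \<open>Here 3 divides \<open>p + 2\<close>, which exceeds 3, so the prime partner can only be
  \<open>p - 2\<close>.\<close>

lemma twin_prime_1_mod_3:
  assumes "twin_prime p" "p mod 3 = 1"
  shows "twin_prime (p - 2)" "(p - 2) mod 3 = 2"
proof -
  have p: "prime p" using assms(1) by (simp add: twin_prime_def)
  have "3 dvd p + 2" using assms(2) by presburger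
  moreover have "p + 2 \<noteq> 3" using prime_ge_2_nat[OF p] by linarith
  ultimately have "\<not> prime (p + 2)" using primes_dvd_imp_eq[of 3 "p + 2"] by auto
  then have "prime (p - 2)" using assms(1) by (simp add: twin_prime_def)
  moreover from this have p4: "p \<ge> 4" using prime_ge_2_nat[of "p - 2"] by linarith
  moreover from p4 have "p - 2 + 2 = p" by linarith
  ultimately show "twin_prime (p - 2)" using p unfolding twin_prime_def by metis
  have "r mod 3 = 2" if "(r + 2) mod 3 = 1" for r :: nat using that by presburger
  moreover have "p - 2 + 2 = p" using p4 by linarith
  ultimately show "(p - 2) mod 3 = 2" using assms(2) by metis
qed

text \<open>Here 3 divides \<open>p - 2\<close>, so a prime partner below would have to be 3.
  Together with the preceding lemma, this pairs the two nonzero classes by a shift of 2.\<close>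

lemma twin_prime_2_mod_3:
  assumes "twin_prime p" "p mod 3 = 2"
  shows "twin_prime (p + 2)" "(p + 2) mod 3 = 1"
proof -
  have p: "prime p" using assms(1) by (simp add: twin_prime_def)
  have "prime (p + 2)"
  proof (rule ccontr)
    assume "\<not> prime (p + 2)"
    then have p2: "prime (p - 2)" using assms(1) by (simp add: twin_prime_def)
    then have "p \<ge> 4" using prime_ge_2_nat[of "p - 2"] by linarith
    then have "3 dvd p - 2" using assms(2) by presburger
    then have "p - 2 = 3" using primes_dvd_imp_eq[of 3 "p - 2"] p2 by auto
    \<comment> \<open>The exceptional prime 5 has partners on both sides, as 7 is prime too.\<close>
    then have "p = 5" by simp
    with \<open>\<not> prime (p + 2)\<close> show False by simp
  qed
  then show "twin_prime (p + 2)" using p by (simp add: twin_prime_def)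
  show "(p + 2) mod 3 = 1" using assms(2) by presburger
qed

section \<open>Counting primes by their representations\<close>

lemma twin_prime_count_of_nat:
  "twin_prime_count (real m) = card {p. twin_prime p \<and> p \<le> m}"
  by (simp add: twin_prime_count_def)

lemma finite_twin_primes_le: "finite {p. twin_prime p \<and> p \<le> (m::nat) \<and> P p}"
  by (rule finite_subset[of _ "{..m}"]) auto

text \<open>Each prime from 5 to \<open>m\<close> comes from a pair \<open>(n, p)\<close> with
  \<open>n \<le> s\<close>. The prime 3 allows at most \<open>s\<close> values of \<open>n\<close>,
  a twin prime in class 2 also \<open>s\<close>, but one in class 1 only about
  \<open>2 * s / 3\<close>. Since the two classes are nearly equal in size, the average is 5/6. The
  leading 2 accounts for the primes 2 and 3.\<close>

lemma card_primes_le_twin_primes: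
  fixes m s :: nat
  assumes rep: "\<And>q :: nat. prime q \<Longrightarrow> q \<ge> 5 \<Longrightarrow>
             \<exists>n p :: nat. n \<ge> 1 \<and> twin_prime p \<and> q = n ^ 2 + n + p"
    and s: "m < (s + 1)\<^sup>2"
  shows "real (card {q. prime q \<and> q \<le> m}) \<le> 2 + real s * (5 / 6 * twin_prime_count m + 7 / 6)"
proof -
  define P where "P = (\<lambda>r. {p. twin_prime p \<and> p \<le> m \<and> p mod 3 = r})"
  define N where "N = {1..s}"
  define N' where "N' = {n \<in> {1..s}. n mod 3 \<noteq> 1}"
  have fin [simp]: "finite (P r)" "finite N" "finite N'" for r
    by (auto simp: P_def N_def N'_def finite_twin_primes_le)
  have "inj_on (\<lambda>p. p - 2) (P 1)"
  proof (rule inj_onI)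
    fix p q assume "p \<in> P 1" "q \<in> P 1" and eq: "p - 2 = q - 2"
    then have "p \<ge> 2" "q \<ge> 2" using prime_ge_2_nat by (auto simp: P_def twin_prime_def)
    with eq show "p = q" by linarith
  qed
  moreover have "(\<lambda>p. p - 2) ` P 1 \<subseteq> P 2"
    using twin_prime_1_mod_3 by (auto simp: P_def)
  ultimately have P12: "card (P 1) \<le> card (P 2)" by (rule card_inj_on_le) simp
  \<comment> \<open>The partner \<open>p + 2\<close> lies in \<open>P 1\<close> unless it exceeds
    \<open>m\<close>. Of the two values where that can happen, at most one is 2 modulo 3, so class 2
    has at most one element more than class 1.\<close>
  have "P 2 \<subseteq> (\<lambda>p. p - 2) ` P 1 \<union> {m - 1, m}"
  proof
    fix p assume p: "p \<in> P 2"
    then have t: "twin_prime (p + 2)" "(p + 2) mod 3 = 1"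
      using twin_prime_2_mod_3[of p] by (auto simp: P_def)
    show "p \<in> (\<lambda>p. p - 2) ` P 1 \<union> {m - 1, m}"
    proof (cases "p + 2 \<le> m")
      case True
      then have "p + 2 \<in> P 1" using t by (simp add: P_def)
      then show ?thesis by force
    next
      case False
      then show ?thesis using p by (auto simp: P_def)
    qed
  qed
  then have "P 2 - (\<lambda>p. p - 2) ` P 1 \<subseteq> P 2 \<inter> {m - 1, m}" by blast
  moreover have "card (P 2 \<inter> {m - 1, m}) \<le> 1"
  proof (rule card_le_Suc0_iff_eq[THEN iffD2, simplified One_nat_def[symmetric]])
    show "\<forall>x\<in>P 2 \<inter> {m - 1, m}. \<forall>y\<in>P 2 \<inter> {m - 1, m}. x = y"
    proof (intro ballI)
      fix x y assume "x \<in> P 2 \<inter> {m - 1, m}" "y \<in> P 2 \<inter> {m - 1, m}"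
      then have "x mod 3 = 2" "y mod 3 = 2" "x = m - 1 \<or> x = m" "y = m - 1 \<or> y = m"
        by (auto simp: P_def)
      then show "x = y" by presburger
    qed
  qed simp
  ultimately have "card (P 2 - (\<lambda>p. p - 2) ` P 1) \<le> 1"
    by (meson card_mono fin(1) finite_Int le_trans)
  moreover have "card (P 2) \<le> card (P 2 - (\<lambda>p. p - 2) ` P 1) + card ((\<lambda>p. p - 2) ` P 1)"
    using diff_card_le_card_Diff[of "(\<lambda>p. p - 2) ` P 1" "P 2"] by simp
  moreover have "card ((\<lambda>p. p - 2) ` P 1) \<le> card (P 1)" by (rule card_image_le) simp
  ultimately have P21: "card (P 2) \<le> card (P 1) + 1" by linarith

  have "card (P 1) + card (P 2) = card (P 1 \<union> P 2)"
    by (subst card_Un_disjoint) (auto simp: P_def finite_twin_primes_le)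
  also have "\<dots> \<le> twin_prime_count m"
    unfolding twin_prime_count_of_nat
    by (rule card_mono) (use finite_twin_primes_le[of m "\<lambda>_. True"] in \<open>auto simp: P_def\<close>)
  finally have T: "card (P 1) + card (P 2) \<le> twin_prime_count m" .

  define Q where "Q = {q::nat. prime q \<and> q \<le> m \<and> q \<ge> 5}"
  have "Q \<subseteq> (\<lambda>(n, p). n\<^sup>2 + n + p) ` (N \<times> {3} \<union> N' \<times> P 1 \<union> N \<times> P 2)"
  proof
    fix q assume q: "q \<in> Q"
    then obtain n p where np: "n \<ge> 1" "twin_prime p" "q = n\<^sup>2 + n + p"
      using rep[of q] by (auto simp: Q_def)
    have "n\<^sup>2 < (s + 1)\<^sup>2" using q np s by (simp add: Q_def)
    then have "n \<in> N" using np(1) power_less_imp_less_base[of n 2 "s + 1"] by (simp add: N_def)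
    have "p \<le> m" using q np by (simp add: Q_def)
    have "(n, p) \<in> N \<times> {3} \<union> N' \<times> P 1 \<union> N \<times> P 2"
    proof -
      consider "p mod 3 = 0" | "p mod 3 = 1" | "p mod 3 = 2" by linarith
      then show ?thesis
      proof cases
        case 1
        then have "p = 3"
          using np(2) primes_dvd_imp_eq[of 3 p] by (auto simp: twin_prime_def)
        then show ?thesis using \<open>n \<in> N\<close> by simp
      next
        case 2
        have "n mod 3 \<noteq> 1"
        proof
          assume "n mod 3 = 1"
          then obtain i j where "n = 3 * i + 1" "p = 3 * j + 1" using 2 by (metis mult_div_mod_eq)
          then have "q = 3 * (3 * i\<^sup>2 + 3 * i + j + 1)"
            using np(3) by (simp add: power2_eq_square algebra_simps)
          then have "3 dvd q" by simp
          then show False using q primes_dvd_imp_eq[of 3 q] by (auto simp: Q_def)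
        qed
        then show ?thesis using \<open>n \<in> N\<close> 2 np \<open>p \<le> m\<close> by (simp add: N_def N'_def P_def)
      next
        case 3
        then show ?thesis using \<open>n \<in> N\<close> np \<open>p \<le> m\<close> by (simp add: P_def)
      qed
    qed
    then show "q \<in> (\<lambda>(n, p). n\<^sup>2 + n + p) ` (N \<times> {3} \<union> N' \<times> P 1 \<union> N \<times> P 2)"
      using np(3) by force
  qed
  then have "card Q \<le> card (N \<times> {3} \<union> N' \<times> P 1 \<union> N \<times> P 2)"
    by (rule surj_card_le[rotated]) simp
  also have "\<dots> \<le> card (N \<times> {3::nat}) + card (N' \<times> P 1) + card (N \<times> P 2)"
    by (meson card_Un_le le_trans add_le_mono le_refl)
  also have "\<dots> = s + card N' * card (P 1) + s * card (P 2)"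
    by (simp add: card_cartesian_product N_def)
  finally have Q: "card Q \<le> s + card N' * card (P 1) + s * card (P 2)" .

  have "3 * card N' \<le> 2 * s"
    unfolding N'_def card_not_1_mod_3 by linarith
  then have "real (card N') * real (card (P 1)) \<le> 2 / 3 * real s * real (card (P 1))"
    by (intro mult_right_mono) linarith+
  moreover have "real (card Q) \<le> s + real (card N') * card (P 1) + real s * card (P 2)"
    using of_nat_mono[OF Q, where ?'a = real] by simp
  ultimately have "real (card Q) \<le> real s * (1 + 2 / 3 * card (P 1) + card (P 2))"
    by (simp add: algebra_simps)
  \<comment> \<open>With a and b the sizes of \<open>P 1\<close> and \<open>P 2\<close>, 1 + 2a/3 +
    b = 1 + 5(a + b)/6 + (b - a)/6, and b - a is at most 1; this gives the 7/6.\<close>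
  also have "\<dots> \<le> real s * (5 / 6 * twin_prime_count m + 7 / 6)"
    using P21 T by (intro mult_left_mono) linarith+
  finally have *: "real (card Q) \<le> real s * (5 / 6 * twin_prime_count m + 7 / 6)" .

  have "{q. prime q \<and> q \<le> m} \<subseteq> {2, 3} \<union> Q"
  proof
    fix q assume q: "q \<in> {q. prime q \<and> q \<le> m}"
    then have "q \<ge> 2" "q \<noteq> 4" using prime_ge_2_nat by auto
    then have "q \<in> {2, 3} \<or> q \<ge> 5" by auto
    then show "q \<in> {2, 3} \<union> Q" using q by (auto simp: Q_def)
  qed
  moreover have "finite Q" by (rule finite_subset[of _ "{..m}"]) (auto simp: Q_def)
  ultimately have "card {q. prime q \<and> q \<le> m} \<le> card ({2, 3} \<union> Q)"
    by (intro card_mono) auto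
  also have "\<dots> \<le> 2 + card Q" using card_Un_le[of "{2, 3}" Q] by simp
  finally show ?thesis using * by linarith
qed

section \<open>A Chebyshev lower bound for the number of primes\<close>

text \<open>By induction from the divisor sum of \<open>mangoldt\<close>, which is the logarithm:
  passing from \<open>n\<close> to \<open>Suc n\<close> raises \<open>n div d\<close> by one exactly
  when \<open>d\<close> divides \<open>Suc n\<close>. Terms with \<open>d > n\<close> vanish, and
  the common range up to \<open>N\<close> lets several factorials be combined term by term.\<close>

lemma ln_fact_eq_sum_mangoldt:
  assumes "n \<le> N"
  shows "ln (fact n) = (\<Sum>d\<in>{1..N}. mangoldt d * real (n div d))"
proof -
  have "(\<Sum>d\<in>{1..N}. mangoldt d * real (n div d)) = ln (fact n :: real)" if "n \<le> N" for n
    using that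
  proof (induction n)
    case (Suc n)
    have "ln (real (Suc n)) = (\<Sum>d | d dvd Suc n. mangoldt d)"
      using mangoldt_sum[of "Suc n", where ?'a = real] by simp
    also have "\<dots> = (\<Sum>d\<in>{1..N}. if d dvd Suc n then mangoldt d else 0)"
      using Suc.prems
      by (subst sum.inter_filter[symmetric])
         (auto intro!: sum.cong dest: dvd_imp_le intro: Nat.gr0I simp: Suc_le_eq)
    finally have l: "ln (real (Suc n)) = \<dots>" .
    have "(\<Sum>d\<in>{1..N}. mangoldt d * real (Suc n div d)) =
        (\<Sum>d\<in>{1..N}. mangoldt d * real (n div d) + (if d dvd Suc n then mangoldt d else 0))"
      by (intro sum.cong) (auto simp: div_Suc dvd_eq_mod_eq_0 algebra_simps)
    also have "\<dots> = ln (fact n :: real) + ln (real (Suc n))"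
      using Suc unfolding sum.distrib l by simp
    also have "\<dots> = ln (fact (Suc n))" by (simp add: ln_mult)
    finally show ?case .
  qed simp
  then show ?thesis using assms by simp
qed

text \<open>Grouping the prime powers up to \<open>n\<close> by their prime, each prime
  \<open>p\<close> contributes \<open>ln p\<close> once per power, in total the logarithm of the
  largest power of \<open>p\<close> not exceeding \<open>n\<close>.\<close>

lemma sum_mangoldt_le:
  "(\<Sum>d\<in>{1..n}. mangoldt d) \<le> real (card {p. prime p \<and> p \<le> n}) * ln n"
proof -
  define S where "S = {d \<in> {1..n}. primepow d}"
  define R where "R = {p. prime p \<and> p \<le> n}"
  have [simp]: "finite R" by (rule finite_subset[of _ "{..n}"]) (auto simp: R_def)
  have "(\<Sum>d\<in>{1..n}. mangoldt d) = (\<Sum>d\<in>S. ln (real (aprimedivisor d)))"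
    unfolding S_def by (subst sum.inter_filter) (auto simp: mangoldt_def intro!: sum.cong)
  also have "\<dots> = (\<Sum>p\<in>R. \<Sum>d\<in>{d \<in> S. aprimedivisor d = p}. ln (real (aprimedivisor d)))"
  proof (rule sum.group[symmetric])
    show "aprimedivisor ` S \<subseteq> R"
    proof safe
      fix d assume d: "d \<in> S"
      then have "d > Suc 0" using primepow_gt_Suc_0 by (auto simp: S_def)
      then show "aprimedivisor d \<in> R"
        using aprimedivisor_nat(1)[of d] aprimedivisor_le_nat[of d] d
        by (auto simp: R_def S_def)
    qed
  qed (simp_all add: S_def)
  also have "\<dots> \<le> (\<Sum>p\<in>R. ln n)"
  proof (rule sum_mono)
    fix p assume "p \<in> R"
    then have p: "prime p" "p \<le> n" by (auto simp: R_def)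
    then have p2: "p > 1" using prime_gt_1_nat by blast
    define A where "A = {k. k > 0 \<and> p ^ k \<le> n}"
    have "k < n" if "k \<in> A" for k
      using that p2 power_gt_expt[of p k] by (auto simp: A_def)
    then have "finite A" by (auto intro: finite_subset[of _ "{..<n}"])
    have "1 \<in> A" using p by (simp add: A_def)
    \<comment> \<open>\<open>K\<close> is the number of powers of \<open>p\<close>, with positive
      exponent, that are at most \<open>n\<close>.\<close>
    define K where "K = Max A"
    have "K \<in> A" using \<open>finite A\<close> \<open>1 \<in> A\<close> unfolding K_def by (intro Max_in) auto
    have "{d \<in> S. aprimedivisor d = p} \<subseteq> (\<lambda>k. p ^ k) ` {1..K}"
    proof
      fix d assume "d \<in> {d \<in> S. aprimedivisor d = p}"
      then have d: "d \<in> S" "aprimedivisor d = p" by auto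
      then obtain r k where rk: "prime r" "k > 0" "d = r ^ k" by (auto simp: S_def primepow_def)
      then have "r = p" using d(2) by (simp add: aprimedivisor_prime_power)
      then have "k \<in> A" using d rk by (simp add: A_def S_def)
      then have "k \<le> K" unfolding K_def using \<open>finite A\<close> by simp
      then show "d \<in> (\<lambda>k. p ^ k) ` {1..K}" using rk \<open>r = p\<close> by auto
    qed
    then have "card {d \<in> S. aprimedivisor d = p} \<le> K"
      using surj_card_le[of "{1..K}"] by fastforce
    then have "(\<Sum>d\<in>{d \<in> S. aprimedivisor d = p}. ln (real (aprimedivisor d))) \<le> real K * ln p"
      using p2 by (simp add: mult_right_mono)
    also have "\<dots> = ln (real (p ^ K))" using p2 by (simp add: ln_realpow)
    also have "\<dots> \<le> ln n" using \<open>K \<in> A\<close> p p2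
      by (subst ln_le_cancel_iff) (auto simp: A_def simp del: of_nat_power)
    finally show "(\<Sum>d\<in>{d \<in> S. aprimedivisor d = p}. ln (real (aprimedivisor d))) \<le> ln n" .
  qed
  also have "\<dots> = real (card R) * ln n" by simp
  finally show ?thesis by (simp add: R_def)
qed

text \<open>A weak form of Stirling's formula; a logarithmic error suffices. The two induction steps
  rest on ln(1 + 1/n) <= 1/n and on ln y <= y - 1 at y = n/(n + 1).\<close>

lemma ln_fact_bounds:
  assumes "n > 0"
  shows "real n * ln n - n \<le> ln (fact n)" "ln (fact n) \<le> real n * ln n - n + ln n + 1"
proof -
  have "real n * ln n - n \<le> ln (fact n) \<and> ln (fact n) \<le> real n * ln n - n + ln n + 1"
    using assms
  proof (induction n rule: nat_induct_non_zero)
    case (Suc n)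
    have f: "ln (fact (Suc n) :: real) = ln (real (Suc n)) + ln (fact n)"
      by (simp add: ln_mult)
    have "ln (real (Suc n)) - ln n = ln (real (Suc n) / n)"
      using Suc.hyps by (simp add: ln_div)
    also have "real (Suc n) / n = 1 + 1 / n" using Suc.hyps by (simp add: field_simps)
    also have "ln \<dots> \<le> 1 / n" by (rule ln_add_one_self_le_self) simp
    finally have 1: "real n * (ln (real (Suc n)) - ln n) \<le> 1"
      using Suc.hyps by (simp add: field_simps)
    have "ln n - ln (real (Suc n)) = ln (n / real (Suc n))"
      using Suc.hyps by (simp add: ln_div)
    also have "\<dots> \<le> n / real (Suc n) - 1"
      using Suc.hyps by (intro ln_le_minus_one) simp
    finally have 2: "real (Suc n) * (ln n - ln (real (Suc n))) \<le> -1"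
      by (simp add: field_simps)
    show ?case using Suc.IH 1 2 unfolding f by (simp add: algebra_simps)
  qed simp
  then show "real n * ln n - n \<le> ln (fact n)" "ln (fact n) \<le> real n * ln n - n + ln n + 1"
    by simp_all
qed

text \<open>Since 12 + 1 = 6 + 4 + 3, adding 12 to \<open>n\<close> raises both sides equally, so
  only the residues below 12 need checking.\<close>

lemma floor_combination_le_1: "n + n div 12 \<le> 1 + n div 2 + n div 3 + n div (4::nat)"
proof -
  define q r where "q = n div 12" and "r = n mod 12"
  have n: "n = r + 12 * q" by (simp add: q_def r_def)
  have r: "r < 12" by (simp add: r_def)
  have "n div 2 = r div 2 + 6 * q" "n div 3 = r div 3 + 4 * q" "n div 4 = r div 4 + 3 * q"
    "n div 12 = q" using r unfolding n by simp_all
  moreover have "r \<le> 1 + r div 2 + r div 3 + r div 4"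
    using r by presburger
  ultimately show ?thesis using n by linarith
qed

text \<open>The logarithm of (12k)! k! / ((6k)! (4k)! (3k)!) is bounded above through
  \<open>mangoldt\<close> by the prime count and below by Stirling. Because 12 + 1 = 6 + 4 + 3, the
  terms \<open>k * ln k\<close> and the linear terms -a of Stirling cancel, leaving k times 12 ln 12
  - 6 ln 6 - 4 ln 4 - 3 ln 3 = ln 27648. The three factorials in the denominator cause the error
  terms.\<close>

lemma card_primes_ge:
  assumes "k > 0"
  shows "real k * ln 27648 - 3 * ln (12 * k) - 3
           \<le> real (card {p. prime p \<and> p \<le> 12 * k}) * ln (12 * real k)"
proof -
  define n where "n = 12 * k"
  have *: "a \<le> n \<Longrightarrow> ln (fact a :: real) = (\<Sum>d\<in>{1..n}. mangoldt d * real (a div d))" for a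
    by (rule ln_fact_eq_sum_mangoldt)
  have "ln (fact n) + ln (fact k) - ln (fact (6 * k)) - ln (fact (4 * k)) - ln (fact (3 * k))
      = (\<Sum>d\<in>{1..n}. mangoldt d * (real (n div d) + real (k div d) - real (6 * k div d)
            - real (4 * k div d) - real (3 * k div d)))"
    by (subst (1 2 3 4 5) *)
       (auto simp: n_def ring_distribs sum.distrib sum_subtractf)
  also have "\<dots> \<le> (\<Sum>d\<in>{1..n}. mangoldt d * 1)"
  proof (intro sum_mono mult_left_mono mangoldt_nonneg)
    fix d
    \<comment> \<open>Since \<open>n\<close> is a multiple of 12, all five floors are iterated
      floors of the single number \<open>n div d\<close>, to which the floor inequality
      applies.\<close>
    have "(n div d) div 12 = k div d" "(n div d) div 2 = 6 * k div d"
      "(n div d) div 3 = 4 * k div d" "(n div d) div 4 = 3 * k div d"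
      by (simp_all add: n_def div_mult2_eq[symmetric] mult.commute[of d])
    then show "real (n div d) + real (k div d) - real (6 * k div d)
            - real (4 * k div d) - real (3 * k div d) \<le> 1"
      using floor_combination_le_1[of "n div d"] by linarith
  qed
  also have "\<dots> \<le> real (card {p. prime p \<and> p \<le> n}) * ln n"
    using sum_mangoldt_le by simp
  finally have up: "ln (fact n) + ln (fact k) - ln (fact (6 * k)) - ln (fact (4 * k))
      - ln (fact (3 * k)) \<le> real (card {p. prime p \<and> p \<le> n}) * ln n" .
  have "ln (27648 :: real) = ln (2 ^ 10 * 3 ^ 3)" by simp
  also have "\<dots> = ln (2 ^ 10) + ln (3 ^ 3)" by (rule ln_mult_pos) simp_all
  also have "\<dots> = 10 * ln 2 + 3 * ln 3"
    by (simp only: ln_realpow zero_less_numeral of_nat_numeral)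
  finally have c: "ln (27648 :: real) = 10 * ln 2 + 3 * ln 3" .
  have l4: "ln (4 * real k) = 2 * ln 2 + ln k"
    using ln_mult[of 4 "real k"] ln_realpow[of 2 2] assms by simp
  have l3: "ln (3 * real k) = ln 3 + ln k" using assms by (simp add: ln_mult)
  have l6: "ln (6 * real k) = ln 2 + ln 3 + ln k"
    using ln_mult[of 2 "3 * real k"] l3 assms by simp
  have l12: "ln (12 * real k) = 2 * ln 2 + ln 3 + ln k"
    using ln_mult[of 2 "6 * real k"] l6 assms by simp
  have lower: "12 * real k * ln (12 * real k) - 12 * real k \<le> ln (fact n)"
    "real k * ln k - real k \<le> ln (fact k)"
    using ln_fact_bounds(1)[of n] ln_fact_bounds(1)[of k] assms by (simp_all add: n_def)
  have upper:
    "ln (fact (6 * k)) \<le> 6 * real k * ln (6 * real k) - 6 * real k + ln (6 * real k) + 1"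
    "ln (fact (4 * k)) \<le> 4 * real k * ln (4 * real k) - 4 * real k + ln (4 * real k) + 1"
    "ln (fact (3 * k)) \<le> 3 * real k * ln (3 * real k) - 3 * real k + ln (3 * real k) + 1"
    using ln_fact_bounds(2)[of "6 * k"] ln_fact_bounds(2)[of "4 * k"]
      ln_fact_bounds(2)[of "3 * k"] assms by simp_all
  have "real k * ln 27648 = 12 * real k * ln (12 * real k) + real k * ln k
      - 6 * real k * ln (6 * real k) - 4 * real k * ln (4 * real k) - 3 * real k * ln (3 * real k)"
    unfolding c l3 l4 l6 l12 by (simp add: algebra_simps)
  moreover have "ln (6 * real k) + ln (4 * real k) + ln (3 * real k) \<le> 3 * ln (12 * real k)"
    unfolding l3 l4 l6 l12 using ln_gt_zero[of 2] ln_gt_zero[of 3] by simp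
  moreover from up have "ln (fact n) + ln (fact k) - ln (fact (6 * k)) - ln (fact (4 * k))
      - ln (fact (3 * k)) \<le> real (card {p. prime p \<and> p \<le> n}) * ln (12 * real k)"
    by (simp add: n_def)
  ultimately have "real k * ln 27648 - 3 * ln (12 * real k) - 3
      \<le> real (card {p. prime p \<and> p \<le> n}) * ln (12 * real k)"
    using lower upper by linarith
  then show ?thesis by (simp add: n_def)
qed

text \<open>This puts the Chebyshev constant \<open>ln 27648 / 12\<close> above 5/6, the factor lost
  in counting representations.\<close>

lemma ln_27648_gt_10: "ln 27648 > (10 :: real)"
proof -
  have "exp (10 :: real) = exp 1 ^ 10" by (simp add: exp_of_nat_mult[symmetric])
  also have "\<dots> < (272 / 100) ^ 10" by (rule power_strict_mono[OF e_less_272]) auto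
  also have "\<dots> < 27648" by (simp add: power_divide)
  finally show ?thesis by (metis exp_less_cancel_iff exp_ln zero_less_numeral)
qed

section \<open>Lower bound for the twin prime count and infinitude\<close>

theorem theorem6:
  assumes "\<And>q :: nat. prime q \<Longrightarrow> q \<ge> 5 \<Longrightarrow>
             \<exists>n p :: nat. n \<ge> 1 \<and> twin_prime p \<and> q = n ^ 2 + n + p"
  shows "(\<forall>\<^sub>F x :: real in at_top. real (twin_prime_count x) \<ge> sqrt x / ln x) \<and>
         infinite {p. twin_prime p}"
proof -
  define c :: real where "c = ln 27648 / 12"
  have c: "c > 10 / 12" using ln_27648_gt_10 by (simp add: c_def)
  \<comment> \<open>This is the counting bound solved for the number of twin primes, with the
    Chebyshev bound inserted. The shift by 12 comes from rounding \<open>x\<close> to a multiple of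
    12. In \<open>5 * ln x\<close>, 3 comes from the Chebyshev error and 2 from the primes 2 and 3.
    Finally 7/5 is 6/5 times 7/6.\<close>
  have lower: "real (twin_prime_count x) \<ge>
      6 / 5 * ((c * (x - 12) - 5 * ln x - 3) / (sqrt x * ln x)) - 7 / 5"
    if x: "x \<ge> 12" and pos: "c * (x - 12) - 5 * ln x - 3 \<ge> 0" for x
  proof -
    define k where "k = nat \<lfloor>x / 12\<rfloor>"
    define m where "m = 12 * k"
    define s where "s = nat \<lfloor>sqrt m\<rfloor>"
    define \<pi> where "\<pi> = real (card {q. prime q \<and> q \<le> m})"
    have k: "k > 0" "12 * real k \<le> x" "x - 12 < 12 * real k"
      using x unfolding k_def by (simp_all, linarith+)
    have m: "real m = 12 * real k" by (simp add: m_def)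
    have s: "real s \<le> sqrt m" "sqrt m < real s + 1" unfolding s_def by simp_all
    have "(sqrt m)\<^sup>2 < (real s + 1)\<^sup>2" using s by (intro power_strict_mono) auto
    then have "real m < real ((s + 1)\<^sup>2)" by (simp add: add.commute)
    then have ms: "m < (s + 1)\<^sup>2" by (simp only: of_nat_less_iff)
    define T where "T = real (twin_prime_count m)"
    have "\<pi> - 2 \<le> real s * (5 / 6 * T + 7 / 6)"
      using card_primes_le_twin_primes[OF assms ms] by (simp add: \<pi>_def T_def)
    also have "\<dots> \<le> sqrt x * (5 / 6 * T + 7 / 6)"
    proof (rule mult_right_mono)
      show "real s \<le> sqrt x" using s(1) k(2) m real_sqrt_le_mono[of m x] by linarith
    qed (simp add: T_def)
    finally have 1: "\<pi> - 2 \<le> sqrt x * (5 / 6 * T + 7 / 6)" .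
    have "real m \<ge> 12" using k(1) by (simp add: m_def)
    then have lm: "0 < ln (real m)" "ln (real m) \<le> ln x" using k(2) m by auto
    have "c * (x - 12) - 5 * ln x - 3 \<le> c * m - 3 * ln m - 3 - 2 * ln m"
    proof -
      have "c * (x - 12) \<le> c * m" using k m c by (intro mult_left_mono) auto
      then show ?thesis using lm by linarith
    qed
    also have "\<dots> \<le> (\<pi> - 2) * ln m"
      using card_primes_ge[OF k(1)] by (simp add: c_def m \<pi>_def algebra_simps m_def)
    finally have 2: "c * (x - 12) - 5 * ln x - 3 \<le> (\<pi> - 2) * ln m" .
    \<comment> \<open>The sign is what permits replacing \<open>ln m\<close> by the larger
      \<open>ln x\<close>; it is the purpose of the assumption \<open>pos\<close>.\<close>
    then have "\<pi> - 2 \<ge> 0" using pos lm(1) by (smt (verit) mult_neg_pos)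
    then have "(\<pi> - 2) * ln m \<le> (\<pi> - 2) * ln x" using lm by (intro mult_left_mono)
    also have "\<dots> \<le> sqrt x * (5 / 6 * T + 7 / 6) * ln x"
      using 1 lm by (intro mult_right_mono) auto
    finally have "c * (x - 12) - 5 * ln x - 3 \<le> (5 / 6 * T + 7 / 6) * (sqrt x * ln x)"
      using 2 by (simp add: mult_ac)
    then have "(c * (x - 12) - 5 * ln x - 3) / (sqrt x * ln x) \<le> 5 / 6 * T + 7 / 6"
      using x by (subst pos_divide_le_eq) auto
    moreover have "twin_prime_count m \<le> twin_prime_count x"
      unfolding twin_prime_count_def
    proof (rule card_mono)
      show "finite {p. twin_prime p \<and> real p \<le> x}"
        by (rule finite_subset[of _ "{..nat \<lfloor>x\<rfloor>}"]) (auto simp: le_nat_floor)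
    qed (use k m in auto)
    ultimately show ?thesis unfolding T_def by linarith
  qed
  have "\<forall>\<^sub>F x in at_top. c * (x - 12) - 5 * ln x - 3 \<ge> 0"
    using c by real_asymp
  \<comment> \<open>The left side grows like \<open>6 / 5 * c * sqrt x / ln x\<close>, and
    \<open>6 / 5 * c > 1\<close> by the bound on \<open>c\<close>; the surplus absorbs the
    lower-order terms.\<close>
  moreover have "\<forall>\<^sub>F x in at_top.
      6 / 5 * ((c * (x - 12) - 5 * ln x - 3) / (sqrt x * ln x)) - 7 / 5 \<ge> sqrt x / ln x"
    using c by real_asymp
  moreover have "\<forall>\<^sub>F x :: real in at_top. x \<ge> 12" by (rule eventually_ge_at_top)
  ultimately have ev: "\<forall>\<^sub>F x :: real in at_top. real (twin_prime_count x) \<ge> sqrt x / ln x"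
    by eventually_elim (use lower in \<open>force intro: order_trans\<close>)
  have "infinite {p. twin_prime p}"
  proof
    assume fin: "finite {p. twin_prime p}"
    define B where "B = real (card {p. twin_prime p})"
    have "real (twin_prime_count x) \<le> B" for x
      unfolding twin_prime_count_def B_def using fin by (intro of_nat_mono card_mono) auto
    moreover have "\<forall>\<^sub>F x :: real in at_top. sqrt x / ln x > B" by real_asymp
    then have "\<forall>\<^sub>F x in at_top. B < real (twin_prime_count x)"
      using ev by eventually_elim simp
    ultimately have "\<forall>\<^sub>F x :: real in at_top. False" by (simp add: not_less[symmetric])
    then show False by simp
  qed
  with ev show ?thesis by blast
qed

end
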